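(* Let $A$ be a real $n\times n$ matrix. The necessary and sufficient condition for $A$ to be a Markov matrix is that there is an eigenvector $\boldsymbol{\xi}$ of $A$ whose components are all nonnegative and have sum $1$ (that is, an eigenvector $\boldsymbol{\xi}\in S2_n$), and that $AX\in S5_n$ for every $X\in S5_n$, where $$S5_n=\{X : X=Y-\boldsymbol{\xi},\ Y\in S2_n\}.$$ (Evidently $S5_n\subseteq S3_n$.)
   Context: A real $n\times n$ matrix $A=(a_{ij})$ is called a Markov matrix if $a_{ij}\ge 0$ for all $1\le i,j\le n$ and $\sum_{i=1}^n a_{ij}=1$ for every $1\le j\le n$ (each column sums to $1$). It acts on column vectors by $X\mapsto AX$. Notation: $S2_n=\{X=(x_1,\dots,x_n)^T\in\mathbb{R}^n : \sum_{i=1}^n x_i=1,\ x_i\ge 0 \text{ for all } 1\le i\le n\}$ and $S3_n=\{X=(x_1,\dots,x_n)^T\in\mathbb{R}^n : \sum_{i=1}^n x_i=0\}$.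
   Formalization: The eigenvector ξ is required to have eigenvalue 1 (Aξ = ξ); with an arbitrary eigenvalue the condition is not sufficient, as the zero matrix satisfies it but is not Markov. Also n ≥ 1 is assumed. *)

theory Defs
  imports "Jordan_Normal_Form.Char_Poly"
begin

text \<open>Indices run over \<open>0..<n\<close>; matrices act on column vectors, so it is the columns of a Markov
  matrix that sum to 1.\<close>

definition markov_matrix :: "nat \<Rightarrow> real mat \<Rightarrow> bool" where
  "markov_matrix n A \<longleftrightarrow> A \<in> carrier_mat n n
     \<and> (\<forall>i<n. \<forall>j<n. A $$ (i, j) \<ge> 0)
     \<and> (\<forall>j<n. (\<Sum>i<n. A $$ (i, j)) = 1)"

definition S2 :: "nat \<Rightarrow> real vec set" where
  "S2 n = {x \<in> carrier_vec n. (\<Sum>i<n. x $ i) = 1 \<and> (\<forall>i<n. x $ i \<ge> 0)}"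

definition S3 :: "nat \<Rightarrow> real vec set" where
  "S3 n = {x \<in> carrier_vec n. (\<Sum>i<n. x $ i) = 0}"

definition S5 :: "nat \<Rightarrow> real vec \<Rightarrow> real vec set" where
  "S5 n \<xi> = {y - \<xi> | y. y \<in> S2 n}"

text \<open>Pitfall: in the characterization of Markov matrices by an eigenvector \<open>\<xi> \<in> S2 n\<close> and
  invariance of \<open>S5 n \<xi>\<close>, the eigenvector has to belong to the eigenvalue 1 (\<open>A\<xi> = \<xi>\<close>).
  With an unspecified eigenvalue the conditions are not sufficient: the zero matrix, and \<open>c\<cdot>I\<close> for
  any \<open>0 \<le> c < 1\<close>, satisfy them for every \<open>\<xi> \<in> S2 n\<close> but are not Markov matrices.\<close>

end

theory Submission
  imports Defs
begin

text \<open>A matrix is Markov iff it maps the simplex \<open>S2\<close> into itself, as its columns are the images of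
  the vertices. For \<open>\<xi>\<close> fixed by \<open>A\<close>, invariance of the translate \<open>S5\<close> is the same as invariance
  of the simplex. A fixed point in the simplex exists: 1 is an eigenvalue of the transpose (with
  the all-ones vector), hence of \<open>A\<close>; if \<open>A v = v\<close> then \<open>A |v| \<ge> |v|\<close> entrywise, and both sides have
  the same sum, so \<open>|v|\<close> is fixed and can be normalised.\<close>

lemma mult_mat_vec_nth:
  fixes A :: "'a::semiring_0 mat"
  assumes "A \<in> carrier_mat n n" "x \<in> carrier_vec n" "i < n"
  shows "(A *\<^sub>v x) $ i = (\<Sum>j<n. A $$ (i, j) * x $ j)"
  using assms by (auto simp: scalar_prod_def atLeast0LessThan)

text \<open>Swapping the two sums turns the coefficient of \<open>x $ j\<close> into the sum of
  column \<open>j\<close>, which is 1. The entries of \<open>x\<close> may have any total, so this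
  also applies to vectors that are not yet normalised.\<close>

lemma sum_mult_mat_vec_markov:
  assumes "markov_matrix n A" "x \<in> carrier_vec n"
  shows "(\<Sum>i<n. (A *\<^sub>v x) $ i) = (\<Sum>i<n. x $ i)"
proof -
  have "(\<Sum>i<n. (A *\<^sub>v x) $ i) = (\<Sum>i<n. \<Sum>j<n. A $$ (i, j) * x $ j)"
    using assms by (intro sum.cong refl mult_mat_vec_nth) (auto simp: markov_matrix_def)
  also have "\<dots> = (\<Sum>j<n. (\<Sum>i<n. A $$ (i, j)) * x $ j)"
    by (subst sum.swap) (simp add: sum_distrib_right)
  also have "\<dots> = (\<Sum>j<n. x $ j)"
    using assms by (simp add: markov_matrix_def)
  finally show ?thesis .
qed

lemma markov_matrix_iff_S2_invariant:
  assumes A: "A \<in> carrier_mat n n"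
  shows "markov_matrix n A \<longleftrightarrow> (\<forall>x \<in> S2 n. A *\<^sub>v x \<in> S2 n)"
proof
  assume M: "markov_matrix n A"
  show "\<forall>x \<in> S2 n. A *\<^sub>v x \<in> S2 n"
  proof
    fix x assume x: "x \<in> S2 n"
    then have xc: "x \<in> carrier_vec n" by (simp add: S2_def)
    have "(A *\<^sub>v x) $ i \<ge> 0" if "i < n" for i
      unfolding mult_mat_vec_nth[OF A xc that] using M x that
      by (intro sum_nonneg) (auto simp: markov_matrix_def S2_def)
    then show "A *\<^sub>v x \<in> S2 n"
      using A x xc sum_mult_mat_vec_markov[OF M xc] by (simp add: S2_def)
  qed
next
  assume inv: "\<forall>x \<in> S2 n. A *\<^sub>v x \<in> S2 n"
  \<comment> \<open>Membership of column \<open>j\<close> in \<open>S2 n\<close> is exactly the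
    Markov condition on that column: nonnegative entries with sum 1.\<close>
  have col: "A *\<^sub>v unit_vec n j \<in> S2 n" "\<And>i. i < n \<Longrightarrow> (A *\<^sub>v unit_vec n j) $ i = A $$ (i, j)"
    if j: "j < n" for j
  proof -
    have "unit_vec n j \<in> S2 n"
      using j by (simp add: S2_def unit_vec_def)
    then show "A *\<^sub>v unit_vec n j \<in> S2 n" using inv by blast
    show "(A *\<^sub>v unit_vec n j) $ i = A $$ (i, j)" if "i < n" for i
      using A j that by simp
  qed
  have "A $$ (i, j) \<ge> 0" if "i < n" "j < n" for i j
    using col[OF that(2)] that(1) by (auto simp: S2_def)
  moreover have "(\<Sum>i<n. A $$ (i, j)) = 1" if "j < n" for j
  proof -
    have "(\<Sum>i<n. A $$ (i, j)) = (\<Sum>i<n. (A *\<^sub>v unit_vec n j) $ i)"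
      using col(2)[OF that] by (intro sum.cong) auto
    also have "\<dots> = 1" using col(1)[OF that] unfolding S2_def by blast
    finally show ?thesis .
  qed
  ultimately show "markov_matrix n A"
    using A by (simp add: markov_matrix_def)
qed

lemma eigenvalue_one_markov:
  assumes "n \<ge> 1" and M: "markov_matrix n A"
  shows "eigenvalue A 1"
proof -
  have A: "A \<in> carrier_mat n n" using M by (simp add: markov_matrix_def)
  let ?u = "vec n (\<lambda>_. 1 :: real)"
  have "A\<^sup>T *\<^sub>v ?u = ?u"
  proof (rule eq_vecI)
    fix i assume "i < dim_vec ?u"
    then have i: "i < n" by simp
    have "(A\<^sup>T *\<^sub>v ?u) $ i = (\<Sum>j<n. A\<^sup>T $$ (i, j) * ?u $ j)"
      using A i by (intro mult_mat_vec_nth) auto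
    also have "\<dots> = (\<Sum>j<n. A $$ (j, i))" using A i by simp
    also have "\<dots> = 1" using M i by (simp add: markov_matrix_def)
    finally show "(A\<^sup>T *\<^sub>v ?u) $ i = ?u $ i" using i by simp
  qed (use A in auto)
  moreover have "?u \<noteq> 0\<^sub>v n"
  proof
    \<comment> \<open>Since \<open>n \<ge> 1\<close>, there is an entry at index 0 to
      compare.\<close>
    assume "?u = 0\<^sub>v n"
    then have "?u $ 0 = 0\<^sub>v n $ 0" by (rule arg_cong)
    with assms(1) show False by simp
  qed
  ultimately have "eigenvalue A\<^sup>T 1"
    unfolding eigenvalue_def eigenvector_def using A by (intro exI[of _ ?u]) auto
  moreover have "A\<^sup>T \<in> carrier_mat n n" using A by simp
  \<comment> \<open>Eigenvalues are the roots of the characteristic polynomial, which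
    \<open>A\<close> shares with its transpose.\<close>
  ultimately show ?thesis
    using A by (simp add: eigenvalue_root_char_poly)
qed

lemma markov_abs_fixed:
  assumes M: "markov_matrix n A" and v: "v \<in> carrier_vec n" and fix_v: "A *\<^sub>v v = v"
  shows "A *\<^sub>v map_vec abs v = map_vec abs v"
proof -
  let ?w = "map_vec abs v"
  have A: "A \<in> carrier_mat n n" using M by (simp add: markov_matrix_def)
  have w: "?w \<in> carrier_vec n" using v by simp
  have le: "?w $ i \<le> (A *\<^sub>v ?w) $ i" if i: "i < n" for i
  proof -
    have "?w $ i = \<bar>(A *\<^sub>v v) $ i\<bar>" using v i fix_v by simp
    also have "\<dots> \<le> (\<Sum>j<n. \<bar>A $$ (i, j) * v $ j\<bar>)"
      unfolding mult_mat_vec_nth[OF A v i] by (rule sum_abs)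
    \<comment> \<open>As the entries of \<open>A\<close> are nonnegative, the absolute value falls
      on \<open>v\<close> alone.\<close>
    also have "\<dots> = (\<Sum>j<n. A $$ (i, j) * ?w $ j)"
      using M v i by (intro sum.cong) (auto simp: markov_matrix_def abs_mult)
    also have "\<dots> = (A *\<^sub>v ?w) $ i" by (rule mult_mat_vec_nth[OF A w i, symmetric])
    finally show ?thesis .
  qed
  \<comment> \<open>By \<open>le\<close> every summand is nonnegative, so a vanishing total forces
    equality in each entry.\<close>
  have "(\<Sum>i<n. (A *\<^sub>v ?w) $ i - ?w $ i) = 0"
    using sum_mult_mat_vec_markov[OF M w] by (simp add: sum_subtractf)
  then have "\<forall>i\<in>{..<n}. (A *\<^sub>v ?w) $ i - ?w $ i = 0"
    using le by (subst (asm) sum_nonneg_eq_0_iff) auto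
  then show ?thesis
    using A v by (intro eq_vecI) auto
qed

lemma markov_fixed_point:
  assumes "n \<ge> 1" and M: "markov_matrix n A"
  obtains \<xi> where "\<xi> \<in> S2 n" "A *\<^sub>v \<xi> = \<xi>"
proof -
  have A: "A \<in> carrier_mat n n" using M by (simp add: markov_matrix_def)
  obtain v where v: "v \<in> carrier_vec n" "v \<noteq> 0\<^sub>v n" "A *\<^sub>v v = v"
    using eigenvalue_one_markov[OF assms] A by (auto simp: eigenvalue_def eigenvector_def)
  \<comment> \<open>\<open>s\<close> is the 1-norm of \<open>v\<close>, hence the entry sum of
    \<open>map_vec abs v\<close>; dividing by it lands in \<open>S2 n\<close>, and linearity keeps
    the vector fixed.\<close>
  define s where "s = (\<Sum>i<n. \<bar>v $ i\<bar>)"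
  have "s \<noteq> 0"
  proof
    assume "s = 0"
    then have "\<forall>i<n. v $ i = 0" unfolding s_def by (subst (asm) sum_nonneg_eq_0_iff) auto
    then have "v = 0\<^sub>v n" using v(1) by (intro eq_vecI) auto
    with v(2) show False ..
  qed
  moreover have "s \<ge> 0" by (simp add: s_def sum_nonneg)
  ultimately have s: "s > 0" by simp
  let ?w = "map_vec abs v"
  have w: "?w \<in> carrier_vec n" using v by simp
  have "(\<Sum>i<n. ((1 / s) \<cdot>\<^sub>v ?w) $ i) = (\<Sum>i<n. \<bar>v $ i\<bar>) / s"
    unfolding sum_divide_distrib using v by (intro sum.cong) auto
  then have "(1 / s) \<cdot>\<^sub>v ?w \<in> S2 n"
    using v s by (auto simp: S2_def s_def)
  moreover have "A *\<^sub>v ((1 / s) \<cdot>\<^sub>v ?w) = (1 / s) \<cdot>\<^sub>v ?w"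
    using mult_mat_vec[OF A w] markov_abs_fixed[OF M v(1) v(3)] by simp
  ultimately show ?thesis by (rule that)
qed

text \<open>Translation by \<open>\<xi>\<close> is injective on vectors of length \<open>n\<close>,
  so the point of \<open>S2 n\<close> witnessing membership in \<open>S5 n \<xi>\<close> can only be
  \<open>y\<close>.\<close>

lemma minus_mem_S5_iff:
  assumes "\<xi> \<in> carrier_vec n" "y \<in> carrier_vec n"
  shows "y - \<xi> \<in> S5 n \<xi> \<longleftrightarrow> y \<in> S2 n"
proof
  assume "y - \<xi> \<in> S5 n \<xi>"
  then obtain z where z: "z \<in> S2 n" "y - \<xi> = z - \<xi>" by (auto simp: S5_def)
  then have "z \<in> carrier_vec n" by (simp add: S2_def)
  have "y = (y - \<xi>) + \<xi>" using assms by (intro eq_vecI) auto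
  also have "\<dots> = z"
    unfolding z(2) using assms \<open>z \<in> carrier_vec n\<close> by (intro eq_vecI) auto
  finally show "y \<in> S2 n" using z(1) by simp
qed (auto simp: S5_def)

text \<open>Because \<open>A\<close> fixes \<open>\<xi>\<close>, it commutes with translation by
  \<open>-\<xi>\<close>: the image of \<open>y - \<xi>\<close> is
  \<open>A *\<^sub>v y - \<xi>\<close>.\<close>

lemma S5_invariant_iff_S2_invariant:
  assumes A: "A \<in> carrier_mat n n" and \<xi>: "\<xi> \<in> carrier_vec n" "A *\<^sub>v \<xi> = \<xi>"
  shows "(\<forall>X \<in> S5 n \<xi>. A *\<^sub>v X \<in> S5 n \<xi>) \<longleftrightarrow> (\<forall>y \<in> S2 n. A *\<^sub>v y \<in> S2 n)"
proof -
  have "A *\<^sub>v (y - \<xi>) \<in> S5 n \<xi> \<longleftrightarrow> A *\<^sub>v y \<in> S2 n" if "y \<in> S2 n" for y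
  proof -
    have y: "y \<in> carrier_vec n" using that by (simp add: S2_def)
    have "A *\<^sub>v (y - \<xi>) = A *\<^sub>v y - \<xi>"
      using mult_minus_distrib_mat_vec[OF A y \<xi>(1)] \<xi>(2) by simp
    then show ?thesis using minus_mem_S5_iff[OF \<xi>(1), of "A *\<^sub>v y"] A y by simp
  qed
  moreover have "S5 n \<xi> = (\<lambda>y. y - \<xi>) ` S2 n" by (auto simp: S5_def)
  ultimately show ?thesis by simp
qed

lemma S5_subset_S3:
  assumes "\<xi> \<in> S2 n"
  shows "S5 n \<xi> \<subseteq> S3 n"
  using assms by (auto simp: S5_def S2_def S3_def sum_subtractf)

theorem theorem8:
  fixes n :: nat and A :: "real mat"
  assumes "n \<ge> 1" and "A \<in> carrier_mat n n"
  shows "(markov_matrix n A \<longleftrightarrow>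
           (\<exists>\<xi>. eigenvector A \<xi> 1 \<and> \<xi> \<in> S2 n \<and> (\<forall>X \<in> S5 n \<xi>. A *\<^sub>v X \<in> S5 n \<xi>)))
       \<and> (\<forall>\<xi> \<in> S2 n. S5 n \<xi> \<subseteq> S3 n)"
proof (intro conjI iffI)
  assume M: "markov_matrix n A"
  obtain \<xi> where \<xi>: "\<xi> \<in> S2 n" "A *\<^sub>v \<xi> = \<xi>"
    using markov_fixed_point[OF assms(1) M] .
  have c: "\<xi> \<in> carrier_vec n" using \<xi>(1) by (simp add: S2_def)
  \<comment> \<open>The zero vector has entry sum 0, whereas points of \<open>S2 n\<close> have
    entry sum 1.\<close>
  have "\<xi> \<noteq> 0\<^sub>v n" using \<xi>(1) by (auto simp: S2_def)
  then have "eigenvector A \<xi> 1"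
    using assms(2) c \<xi>(2) by (simp add: eigenvector_def)
  then show "\<exists>\<xi>. eigenvector A \<xi> 1 \<and> \<xi> \<in> S2 n \<and> (\<forall>X \<in> S5 n \<xi>. A *\<^sub>v X \<in> S5 n \<xi>)"
    using \<xi>(1) M S5_invariant_iff_S2_invariant[OF assms(2) c \<xi>(2)]
      markov_matrix_iff_S2_invariant[OF assms(2)] by blast
next
  assume "\<exists>\<xi>. eigenvector A \<xi> 1 \<and> \<xi> \<in> S2 n \<and> (\<forall>X \<in> S5 n \<xi>. A *\<^sub>v X \<in> S5 n \<xi>)"
  then obtain \<xi> where \<xi>: "eigenvector A \<xi> 1" "\<forall>X \<in> S5 n \<xi>. A *\<^sub>v X \<in> S5 n \<xi>"
    by blast
  from \<xi>(1) have "\<xi> \<in> carrier_vec n" "A *\<^sub>v \<xi> = \<xi>"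
    using assms(2) by (auto simp: eigenvector_def)
  \<comment> \<open>Invariance passes from \<open>S5 n \<xi>\<close> to \<open>S2 n\<close> by
    translating back, and invariance of \<open>S2 n\<close> characterises Markov matrices.\<close>
  then show "markov_matrix n A"
    using \<xi>(2) S5_invariant_iff_S2_invariant[OF assms(2)]
      markov_matrix_iff_S2_invariant[OF assms(2)] by blast
next
  show "\<forall>\<xi> \<in> S2 n. S5 n \<xi> \<subseteq> S3 n" using S5_subset_S3 by blast
qed

end
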